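(* Let $(a_k)_{k\ge0}$ and $(b_k)_{k\ge-1}$ be the polynomial sequences in $u,t$ defined by $$a_k=(u+2t+3)a_{k-1}-(t+1)^2a_{k-2},\qquad b_k=(u+2t+3)b_{k-1}-(t+1)^2b_{k-2},$$ with initial conditions $b_{-1}=0$, $a_0=b_0=1$, $a_1=u+3t+4$. Let $n\ge3$. Then the unnormalized stationary distribution $\pi=\pi_{\mathrm{DASEP}}$ of $\mathrm{DASEP}(n,2,2)$ is as follows (all values below being given up to one common multiplicative constant). For every state $\mu$ and integer $m\ge0$, write $\mu=[1\,0^m\,2]$ if $\mu$ has entry $1$ at some position $i$ and entry $2$ at position $i+m+1$ (mod $n$), all other entries $0$; and $\mu=[2\,0^m\,1]$ if $\mu$ has entry $2$ at position $i$ and entry $1$ at position $i+m+1$ (mod $n$), all other entries $0$. If $n=2k+1$ is odd: $\pi(\mu)=a_k$ for every $\mu\in S_n((1,1,0,\dots,0))$; $\pi(\mu)=u a_k+u(t-1)(t+1)^m a_{k-m-1}$ for $\mu=[1\,0^m\,2]$, $0\le m<k$; $\pi(\mu)=u a_k-u(t-1)(t+1)^m a_{k-m-1}$ for $\mu=[2\,0^m\,1]$, $0\le m<k$; $\pi(\mu)=u^2a_k$ for every $\mu\in S_n((2,2,0,\dots,0))$. If $n=2k+2$ is even: $\pi(\mu)=b_k$ for every $\mu\in S_n((1,1,0,\dots,0))$; $\pi(\mu)=u b_k+u(t-1)(t+1)^m b_{k-m-1}$ for $\mu=[1\,0^m\,2]$, $0\le m\le k$; $\pi(\mu)=u b_k-u(t-1)(t+1)^m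 b_{k-m-1}$ for $\mu=[2\,0^m\,1]$, $0\le m\le k$; $\pi(\mu)=u^2b_k$ for every $\mu\in S_n((2,2,0,\dots,0))$.
   Context: $S_n(\lambda)$ is the set of distinct rearrangements of the $n$-tuple $\lambda$. $\mathrm{DASEP}(n,2,2)$ with parameters $t,u$ (constants in $[0,1]$, treated as formal variables): state space = all $n$-tuples with entries in $\{0,1,2\}$ with exactly $2$ nonzero entries (ring of $n$ sites; $0$ is a hole). Positions are cyclic, position $n$ followed by position $1$. Transitions $P(\mu,\nu)$: swapping entries $a=\mu_k\ne b=\mu_{k+1}$ at cyclically consecutive positions $k,k+1$ has probability $\frac{1}{3n}$ if $b>a$ and $\frac{t}{3n}$ if $a>b$; changing one entry $1$ to $2$ has probability $\frac{u}{3n}$; changing one entry $2$ to $1$ has probability $\frac{1}{3n}$; other off-diagonal probabilities $0$, and $P(\mu,\mu)=1-\sum_{\nu\neq\mu}P(\mu,\nu)$. The unnormalized stationary distribution is the stationary measure whose values are polynomials in $u,t$ with gcd $1$. *)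

theory Defs
  imports
    Complex_Main
    "HOL-Computational_Algebra.Computational_Algebra"
    "HOL-Computational_Algebra.Field_as_Ring"
    "HOL-Combinatorics.Multiset_Permutations"
begin

text \<open>
  The ring of polynomials in \<open>u\<close> and \<open>t\<close> over the rationals is rendered as \<open>rat poly poly\<close>: the
  outer variable is \<open>u\<close>, the inner one is \<open>t\<close>. All transition probabilities are elements of this
  ring, because the only denominators are the integers \<open>3 n\<close>.
\<close>

type_synonym poly_ut = "rat poly poly"

definition const_ut :: "rat \<Rightarrow> poly_ut" where
  "const_ut c = [:[:c:]:]"

definition var_u :: poly_ut where
  "var_u = [:0, 1:]"

definition var_t :: poly_ut where
  "var_t = [:[:0, 1:]:]"

text \<open>
  A state is a list of length \<open>n\<close>; sites are numbered \<open>0, \<dots>, n - 1\<close>, and the site after \<open>k\<close> is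
  \<open>(k + 1) mod n\<close>.
\<close>

definition dasep_states :: "nat \<Rightarrow> nat list set" where
  "dasep_states n =
     {\<mu>. length \<mu> = n \<and> set \<mu> \<subseteq> {0, 1, 2} \<and> card {i. i < n \<and> \<mu> ! i \<noteq> 0} = 2}"

definition swap_next :: "nat \<Rightarrow> nat \<Rightarrow> nat list \<Rightarrow> nat list" where
  "swap_next n k \<mu> = \<mu>[k := \<mu> ! (Suc k mod n), Suc k mod n := \<mu> ! k]"

text \<open>
  For \<open>n \<ge> 3\<close> distinct moves out of \<open>\<mu>\<close> lead to distinct states, so for \<open>\<nu> \<noteq> \<mu>\<close> at most one
  summand below is nonzero.
\<close>

definition dasep_rate :: "nat \<Rightarrow> nat list \<Rightarrow> nat list \<Rightarrow> poly_ut" where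
  "dasep_rate n \<mu> \<nu> =
     (\<Sum>k<n. if \<mu> ! k < \<mu> ! (Suc k mod n) \<and> \<nu> = swap_next n k \<mu>
             then const_ut (1 / (3 * of_nat n)) else 0) +
     (\<Sum>k<n. if \<mu> ! k > \<mu> ! (Suc k mod n) \<and> \<nu> = swap_next n k \<mu>
             then const_ut (1 / (3 * of_nat n)) * var_t else 0) +
     (\<Sum>k<n. if \<mu> ! k = 1 \<and> \<nu> = \<mu>[k := 2]
             then const_ut (1 / (3 * of_nat n)) * var_u else 0) +
     (\<Sum>k<n. if \<mu> ! k = 2 \<and> \<nu> = \<mu>[k := 1]
             then const_ut (1 / (3 * of_nat n)) else 0)"

definition dasep_P :: "nat \<Rightarrow> nat list \<Rightarrow> nat list \<Rightarrow> poly_ut" where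
  "dasep_P n \<mu> \<nu> =
     (if \<mu> = \<nu> then 1 - (\<Sum>\<kappa> \<in> dasep_states n - {\<mu>}. dasep_rate n \<mu> \<kappa>)
      else dasep_rate n \<mu> \<nu>)"

definition dasep_stationary :: "nat \<Rightarrow> (nat list \<Rightarrow> poly_ut) \<Rightarrow> bool" where
  "dasep_stationary n \<pi> \<longleftrightarrow>
     (\<forall>\<nu> \<in> dasep_states n. (\<Sum>\<mu> \<in> dasep_states n. \<pi> \<mu> * dasep_P n \<mu> \<nu>) = \<pi> \<nu>)"

text \<open>
  The condition on the gcd also excludes the zero measure. Over the rationals it determines the
  values up to a common nonzero rational factor.
\<close>

definition dasep_unnormalized :: "nat \<Rightarrow> (nat list \<Rightarrow> poly_ut) \<Rightarrow> bool" where
  "dasep_unnormalized n \<pi> \<longleftrightarrow> dasep_stationary n \<pi> \<and> Gcd (\<pi> ` dasep_states n) = 1"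

text \<open>For an \<open>n\<close>-tuple \<open>xs\<close>, this is the set \<open>S\<^sub>n(xs)\<close> of its distinct rearrangements.\<close>

definition rearrangements :: "nat list \<Rightarrow> nat list set" where
  "rearrangements xs = permutations_of_multiset (mset xs)"

text \<open>\<open>gap_state n x m y \<mu>\<close> says that \<open>\<mu> = [x 0\<^sup>m y]\<close>.\<close>

definition gap_state :: "nat \<Rightarrow> nat \<Rightarrow> nat \<Rightarrow> nat \<Rightarrow> nat list \<Rightarrow> bool" where
  "gap_state n x m y \<mu> \<longleftrightarrow>
     length \<mu> = n \<and>
     (\<exists>i<n. \<mu> ! i = x \<and> \<mu> ! ((i + m + 1) mod n) = y \<and>
       (\<forall>j<n. j \<noteq> i \<and> j \<noteq> (i + m + 1) mod n \<longrightarrow> \<mu> ! j = 0))"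

end

theory Submission
  imports Defs
begin

text \<open>
  Give the state with a \<open>1\<close> at site \<open>i\<close> and a \<open>2\<close> at site \<open>j\<close> the weight
  \<open>u A + u (t - 1) H(d)\<close>, where \<open>d\<close> is the cyclic distance from \<open>i\<close> to \<open>j\<close>, and the states with
  two equal particles the weights \<open>A\<close> and \<open>u\<^sup>2 A\<close>. The balance equations then reduce to
  \<open>H(n - d) = - H(d)\<close>, the boundary equation \<open>A + (t + 1) H(2) = (u + 2t + 3) H(1)\<close> and
  \<open>(t + 1) (H(d - 1) + H(d + 1)) = (u + 2t + 3) H(d)\<close>. With \<open>N = \<lfloor>n/2\<rfloor>\<close> the solution is
  \<open>H(d) = (t + 1)\<^bsup>d-1\<^esup> c\<^bsub>N-d\<^esub>\<close> for \<open>d \<le> N\<close> and \<open>A = c\<^bsub>N\<^esub>\<close>, where \<open>c\<close> obeys the recurrence of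
  \<open>a\<close> and \<open>b\<close> and its two initial values encode the antisymmetry of \<open>H\<close> at the antipode: \<open>c = a\<close> for
  odd \<open>n\<close>, \<open>c\<^bsub>k\<^esub> = b\<^bsub>k-1\<^esub>\<close> for even \<open>n\<close>.

  For uniqueness, the polynomial ring is an ordered ring (by sign of the leading coefficient) in
  which all rates are nonnegative. Hence the absolute value of a stationary vector is stationary, so its zeros propagate
  backwards along transitions, and a stationary vector with one zero vanishes by irreducibility.

  The weights have gcd \<open>1\<close>: a common divisor divides \<open>A\<close>, which is monic in \<open>u\<close> with nonzero
  constant term, and \<open>u (t - 1) (t + 1)\<^bsup>e\<^esup>\<close> for some \<open>e\<close>.
\<close>

section \<open>Balance equations over an ordered ring\<close>

text \<open>The triangle inequality bounds outflow by inflow at every state for the vector of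
  absolute values. Summed over \<open>S\<close>, both sides become the same double sum, so each of
  these inequalities is an equality.\<close>

lemma balance_abs:
  fixes x :: "'s \<Rightarrow> 'a :: linordered_idom" and r :: "'s \<Rightarrow> 's \<Rightarrow> 'a"
  assumes fin: "finite S"
    and nonneg: "\<And>\<mu> \<nu>. 0 \<le> r \<mu> \<nu>"
    and bal: "\<And>\<nu>. \<nu> \<in> S \<Longrightarrow> (\<Sum>\<mu>\<in>S. x \<mu> * r \<mu> \<nu>) = x \<nu> * (\<Sum>\<kappa>\<in>S. r \<nu> \<kappa>)"
    and \<nu>: "\<nu> \<in> S"
  shows "(\<Sum>\<mu>\<in>S. \<bar>x \<mu>\<bar> * r \<mu> \<nu>) = \<bar>x \<nu>\<bar> * (\<Sum>\<kappa>\<in>S. r \<nu> \<kappa>)"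
proof -
  let ?in = "\<lambda>\<nu>. \<Sum>\<mu>\<in>S. \<bar>x \<mu>\<bar> * r \<mu> \<nu>" and ?out = "\<lambda>\<nu>. \<bar>x \<nu>\<bar> * (\<Sum>\<kappa>\<in>S. r \<nu> \<kappa>)"
  have le: "?out \<nu> \<le> ?in \<nu>" if "\<nu> \<in> S" for \<nu>
  proof -
    have "?out \<nu> = \<bar>\<Sum>\<mu>\<in>S. x \<mu> * r \<mu> \<nu>\<bar>"
      using bal[OF that] nonneg by (simp add: abs_mult sum_nonneg)
    also have "\<dots> \<le> (\<Sum>\<mu>\<in>S. \<bar>x \<mu> * r \<mu> \<nu>\<bar>)"
      by (rule sum_abs)
    also have "\<dots> = ?in \<nu>"
      using nonneg by (simp add: abs_mult)
    finally show ?thesis .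
  qed
  have "sum ?in S = (\<Sum>\<mu>\<in>S. \<Sum>\<nu>\<in>S. \<bar>x \<mu>\<bar> * r \<mu> \<nu>)"
    by (rule sum.swap)
  also have "\<dots> = sum ?out S"
    by (simp add: sum_distrib_left)
  finally have "(\<Sum>\<nu>\<in>S. ?in \<nu> - ?out \<nu>) = 0"
    by (simp add: sum_subtractf)
  then have "?in \<nu> - ?out \<nu> = 0"
    using sum_nonneg_eq_0_iff[OF fin, of "\<lambda>\<nu>. ?in \<nu> - ?out \<nu>"] le \<nu> by simp
  then show ?thesis
    by simp
qed

text \<open>After passing to absolute values the inflow at \<open>\<nu>\<close> is a vanishing sum
  of nonnegative terms, so each term is 0.\<close>

lemma balance_zero_backward:
  fixes x :: "'s \<Rightarrow> 'a :: linordered_idom" and r :: "'s \<Rightarrow> 's \<Rightarrow> 'a"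
  assumes fin: "finite S"
    and nonneg: "\<And>\<mu> \<nu>. 0 \<le> r \<mu> \<nu>"
    and bal: "\<And>\<nu>. \<nu> \<in> S \<Longrightarrow> (\<Sum>\<mu>\<in>S. x \<mu> * r \<mu> \<nu>) = x \<nu> * (\<Sum>\<kappa>\<in>S. r \<nu> \<kappa>)"
    and "\<nu> \<in> S" "x \<nu> = 0" "\<mu> \<in> S" "r \<mu> \<nu> \<noteq> 0"
  shows "x \<mu> = 0"
proof -
  have "(\<Sum>\<mu>\<in>S. \<bar>x \<mu>\<bar> * r \<mu> \<nu>) = 0"
    using balance_abs[OF fin nonneg bal \<open>\<nu> \<in> S\<close>] \<open>x \<nu> = 0\<close> by simp
  then have "\<bar>x \<mu>\<bar> * r \<mu> \<nu> = 0"
    using sum_nonneg_eq_0_iff[OF fin, of "\<lambda>\<mu>. \<bar>x \<mu>\<bar> * r \<mu> \<nu>"] nonneg \<open>\<mu> \<in> S\<close> by simp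
  then show ?thesis
    using \<open>r \<mu> \<nu> \<noteq> 0\<close> by simp
qed

section \<open>Positivity of the rate coefficients in the order of \<open>poly_ut\<close>\<close>

lemma const_ut_pos: "0 < c \<Longrightarrow> 0 < const_ut c"
  by (simp add: const_ut_def less_poly_def pos_poly_def)

lemma var_u_pos: "0 < var_u"
  by (simp add: var_u_def less_poly_def pos_poly_def)

lemma var_t_pos: "0 < var_t"
  by (simp add: var_t_def less_poly_def pos_poly_def)

section \<open>States and moves\<close>

lemma finite_dasep_states: "finite (dasep_states n)"
  by (rule finite_subset[OF _ finite_lists_length_eq[of "{0, 1, 2}" n]])
     (auto simp: dasep_states_def)

text \<open>The particles are listed in an order, so each state has two descriptions, exchanged by
  \<open>two_at_sym\<close>; later arguments pick the convenient one.\<close>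

definition two_at :: "nat \<Rightarrow> nat \<Rightarrow> nat \<Rightarrow> nat \<Rightarrow> nat \<Rightarrow> nat list \<Rightarrow> bool" where
  "two_at n i x j y \<mu> \<longleftrightarrow> length \<mu> = n \<and> i < n \<and> j < n \<and> i \<noteq> j \<and> \<mu> ! i = x \<and> \<mu> ! j = y \<and>
     (\<forall>k<n. k \<noteq> i \<longrightarrow> k \<noteq> j \<longrightarrow> \<mu> ! k = 0)"

lemma two_at_sym: "two_at n i x j y \<mu> \<longleftrightarrow> two_at n j y i x \<mu>"
  by (auto simp: two_at_def)

lemma two_at_unique: "two_at n i x j y \<mu> \<Longrightarrow> two_at n i x j y \<nu> \<Longrightarrow> \<mu> = \<nu>"
  by (rule nth_equalityI) (auto simp: two_at_def, metis)

lemma two_at_ex: "i < n \<Longrightarrow> j < n \<Longrightarrow> i \<noteq> j \<Longrightarrow> \<exists>\<mu>. two_at n i x j y \<mu>"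
  by (rule exI[of _ "(replicate n 0)[i := x, j := y]"]) (auto simp: two_at_def nth_list_update)

lemma two_at_in_states:
  assumes "two_at n i x j y \<mu>" "x \<in> {1, 2}" "y \<in> {1, 2}"
  shows "\<mu> \<in> dasep_states n"
proof -
  have "{k. k < n \<and> \<mu> ! k \<noteq> 0} = {i, j}"
    using assms by (auto simp: two_at_def)
  moreover have "set \<mu> \<subseteq> {0, 1, 2}"
    using assms by (force simp: two_at_def in_set_conv_nth)
  ultimately show ?thesis
    using assms by (auto simp: dasep_states_def two_at_def)
qed

lemma dasep_states_two_at:
  assumes "\<mu> \<in> dasep_states n"
  obtains i x j y where "two_at n i x j y \<mu>" "x \<in> {1, 2}" "y \<in> {1, 2}"
proof -
  from assms obtain i j where ij: "{k. k < n \<and> \<mu> ! k \<noteq> 0} = {i, j}" "i \<noteq> j"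
    by (auto simp: dasep_states_def card_2_iff)
  have ij_in: "i \<in> {k. k < n \<and> \<mu> ! k \<noteq> 0}" "j \<in> {k. k < n \<and> \<mu> ! k \<noteq> 0}"
    unfolding ij(1) by simp_all
  have "\<mu> ! k \<in> {0, 1, 2}" if "k < n" for k
    using assms that by (auto simp: dasep_states_def dest: nth_mem)
  from this[of i] this[of j] have "\<mu> ! i \<in> {1, 2}" "\<mu> ! j \<in> {1, 2}"
    using ij_in by simp_all
  moreover have "two_at n i (\<mu> ! i) j (\<mu> ! j) \<mu>"
    using assms ij by (auto simp: two_at_def dasep_states_def)
  ultimately show thesis
    by (intro that)
qed

section \<open>Moves of two-particle states\<close>

lemma length_swap_next [simp]: "length (swap_next n k \<mu>) = length \<mu>"
  by (simp add: swap_next_def)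

lemma Suc_mod_neq: "2 \<le> n \<Longrightarrow> k < n \<Longrightarrow> Suc k mod n \<noteq> k"
  by (cases "Suc k = n") auto

lemma nth_swap_next:
  assumes "2 \<le> n" "k < n" "length \<mu> = n" "l < n"
  shows "swap_next n k \<mu> ! l =
    (if l = k then \<mu> ! (Suc k mod n) else if l = Suc k mod n then \<mu> ! k else \<mu> ! l)"
  using assms Suc_mod_neq[of n k] by (auto simp: swap_next_def nth_list_update)

lemma swap_next_involution:
  assumes "2 \<le> n" "k < n" "length \<mu> = n"
  shows "swap_next n k (swap_next n k \<mu>) = \<mu>"
proof (rule nth_equalityI)
  fix l assume "l < length (swap_next n k (swap_next n k \<mu>))"
  moreover have "Suc k mod n < n"
    using assms by simp
  ultimately show "swap_next n k (swap_next n k \<mu>) ! l = \<mu> ! l"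
    using assms Suc_mod_neq[of n k] by (simp add: nth_swap_next)
qed simp

lemma two_at_swap_forward:
  assumes "2 \<le> n" "two_at n i x j y \<mu>" "Suc i mod n \<noteq> j"
  shows "two_at n (Suc i mod n) x j y (swap_next n i \<mu>)"
  using assms Suc_mod_neq[of n i] by (auto simp: two_at_def nth_swap_next)

lemma two_at_swap_backward:
  assumes "2 \<le> n" "two_at n i x j y \<mu>" "k < n" "k \<noteq> j" "Suc k mod n = i"
  shows "two_at n k x j y (swap_next n k \<mu>)"
  using assms Suc_mod_neq[of n k] by (auto simp: two_at_def nth_swap_next)

lemma two_at_swap_adjacent:
  assumes "2 \<le> n" "two_at n i x j y \<mu>" "Suc i mod n = j"
  shows "two_at n i y j x (swap_next n i \<mu>)"
  using assms by (auto simp: two_at_def nth_swap_next)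

lemma two_at_update:
  assumes "two_at n i x j y \<mu>"
  shows "two_at n i x' j y (\<mu>[i := x'])"
  using assms by (auto simp: two_at_def nth_list_update)

lemma swap_next_in_states:
  assumes "2 \<le> n" "k < n" "\<mu> \<in> dasep_states n"
  shows "swap_next n k \<mu> \<in> dasep_states n"
proof -
  obtain i x j y where *: "two_at n i x j y \<mu>" "x \<in> {1, 2}" "y \<in> {1, 2}"
    using assms dasep_states_two_at by blast
  have sym: "two_at n j y i x \<mu>"
    using * two_at_sym by blast
  \<comment> \<open>The first six cases are the edges touching a particle. In the last one the edge
    joins two holes and the swap changes nothing.\<close>
  consider "k = i" "Suc k mod n = j" | "k = j" "Suc k mod n = i"
    | "k = i" "Suc k mod n \<noteq> j" | "k = j" "Suc k mod n \<noteq> i"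
    | "k \<noteq> j" "Suc k mod n = i" | "k \<noteq> i" "Suc k mod n = j"
    | "k \<noteq> i" "k \<noteq> j" "Suc k mod n \<noteq> i" "Suc k mod n \<noteq> j"
    by blast
  then show ?thesis
  proof cases
    case 7
    then have "two_at n i x j y (swap_next n k \<mu>)"
      using assms * by (auto simp: two_at_def nth_swap_next)
    then show ?thesis
      using * two_at_in_states by blast
  qed (use assms * sym two_at_swap_adjacent two_at_swap_forward two_at_swap_backward
        two_at_in_states in metis)+
qed

lemma update_in_states:
  assumes "\<mu> \<in> dasep_states n" "k < n" "\<mu> ! k \<noteq> 0" "z \<in> {1, 2}"
  shows "\<mu>[k := z] \<in> dasep_states n"
proof -
  obtain i x j y where *: "two_at n i x j y \<mu>" "x \<in> {1, 2}" "y \<in> {1, 2}"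
    using assms dasep_states_two_at by blast
  then have "k = i \<or> k = j"
    using assms by (auto simp: two_at_def)
  then show ?thesis
    using * assms two_at_update two_at_in_states two_at_sym by metis
qed

section \<open>Transition rates\<close>

lemma dasep_rate_nonneg: "0 \<le> dasep_rate n \<mu> \<nu>"
proof (cases "n = 0")
  case False
  then have c: "0 \<le> const_ut (1 / (3 * of_nat n))"
    by (intro less_imp_le const_ut_pos) simp
  note ct = mult_nonneg_nonneg[OF c less_imp_le[OF var_t_pos]]
    and cu = mult_nonneg_nonneg[OF c less_imp_le[OF var_u_pos]]
  show ?thesis
    unfolding dasep_rate_def
    by (intro add_nonneg_nonneg sum_nonneg; simp only: c ct cu order_refl split: if_split; blast)
qed (simp add: dasep_rate_def)

text \<open>All four sums in \<open>dasep_rate\<close> are nonnegative, so nothing cancels and one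
  positive summand is enough, whatever other moves lead to the same state.\<close>

lemma dasep_rate_swap_neq_0:
  assumes "k < n" "\<mu> ! k \<noteq> \<mu> ! (Suc k mod n)"
  shows "dasep_rate n \<mu> (swap_next n k \<mu>) \<noteq> 0"
proof -
  let ?c = "const_ut (1 / (3 * of_nat n))" and ?\<nu> = "swap_next n k \<mu>"
  let ?S1 = "\<lambda>k'. if \<mu> ! k' < \<mu> ! (Suc k' mod n) \<and> ?\<nu> = swap_next n k' \<mu> then ?c else 0"
  let ?S2 = "\<lambda>k'. if \<mu> ! k' > \<mu> ! (Suc k' mod n) \<and> ?\<nu> = swap_next n k' \<mu> then ?c * var_t else 0"
  let ?S3 = "\<lambda>k'. if \<mu> ! k' = 1 \<and> ?\<nu> = \<mu>[k' := 2] then ?c * var_u else 0"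
  let ?S4 = "\<lambda>k'. if \<mu> ! k' = 2 \<and> ?\<nu> = \<mu>[k' := 1] then ?c else 0"
  have c: "0 < ?c"
    using assms by (intro const_ut_pos) simp
  note ct = mult_nonneg_nonneg[OF less_imp_le[OF c] less_imp_le[OF var_t_pos]]
    and cu = mult_nonneg_nonneg[OF less_imp_le[OF c] less_imp_le[OF var_u_pos]]
  have nonneg: "0 \<le> sum ?S1 {..<n}" "0 \<le> sum ?S2 {..<n}" "0 \<le> sum ?S3 {..<n}" "0 \<le> sum ?S4 {..<n}"
    using ct cu less_imp_le[OF c] by (intro sum_nonneg; simp only: order_refl split: if_split; blast)+
  have "0 < sum ?S1 {..<n} \<or> 0 < sum ?S2 {..<n}"
  proof (cases "\<mu> ! k < \<mu> ! (Suc k mod n)")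
    case True
    then show ?thesis
      using assms c by (intro disjI1 sum_pos2[of _ k]) auto
  next
    case False
    then show ?thesis
      using assms c var_t_pos by (intro disjI2 sum_pos2[of _ k]) auto
  qed
  then have "0 < sum ?S1 {..<n} + sum ?S2 {..<n} + sum ?S3 {..<n} + sum ?S4 {..<n}"
    using nonneg by linarith
  then show ?thesis
    by (simp add: dasep_rate_def)
qed

text \<open>The species other than \<open>x\<close> is \<open>3 - x\<close>, so both directions of
  the change are covered. Again a positive summand cannot be cancelled.\<close>

lemma dasep_rate_update_neq_0:
  assumes "k < n" "x \<in> {1, 2}" "\<mu> ! k = 3 - x"
  shows "dasep_rate n \<mu> (\<mu>[k := x]) \<noteq> 0"
proof -
  let ?c = "const_ut (1 / (3 * of_nat n))" and ?\<nu> = "\<mu>[k := x]"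
  let ?S1 = "\<lambda>k'. if \<mu> ! k' < \<mu> ! (Suc k' mod n) \<and> ?\<nu> = swap_next n k' \<mu> then ?c else 0"
  let ?S2 = "\<lambda>k'. if \<mu> ! k' > \<mu> ! (Suc k' mod n) \<and> ?\<nu> = swap_next n k' \<mu> then ?c * var_t else 0"
  let ?S3 = "\<lambda>k'. if \<mu> ! k' = 1 \<and> ?\<nu> = \<mu>[k' := 2] then ?c * var_u else 0"
  let ?S4 = "\<lambda>k'. if \<mu> ! k' = 2 \<and> ?\<nu> = \<mu>[k' := 1] then ?c else 0"
  have c: "0 < ?c"
    using assms by (intro const_ut_pos) simp
  note ct = mult_nonneg_nonneg[OF less_imp_le[OF c] less_imp_le[OF var_t_pos]]
    and cu = mult_nonneg_nonneg[OF less_imp_le[OF c] less_imp_le[OF var_u_pos]]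
  have nonneg: "0 \<le> sum ?S1 {..<n}" "0 \<le> sum ?S2 {..<n}" "0 \<le> sum ?S3 {..<n}" "0 \<le> sum ?S4 {..<n}"
    using ct cu less_imp_le[OF c] by (intro sum_nonneg; simp only: order_refl split: if_split; blast)+
  have "0 < sum ?S3 {..<n} \<or> 0 < sum ?S4 {..<n}"
  proof (cases "x = 2")
    case True
    then show ?thesis
      using assms c var_u_pos by (intro disjI1 sum_pos2[of _ k]) auto
  next
    case False
    then show ?thesis
      using assms c by (intro disjI2 sum_pos2[of _ k]) auto
  qed
  then have "0 < sum ?S1 {..<n} + sum ?S2 {..<n} + sum ?S3 {..<n} + sum ?S4 {..<n}"
    using nonneg by linarith
  then show ?thesis
    by (simp add: dasep_rate_def)
qed

text \<open>The off-diagonal sums in \<open>dasep_P\<close> are completed by the diagonal rate,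
  which adds \<open>\<pi> \<nu> * dasep_rate n \<nu> \<nu>\<close> to inflow and outflow
  alike.\<close>

lemma dasep_stationary_iff_balance:
  "dasep_stationary n \<pi> \<longleftrightarrow> (\<forall>\<nu>\<in>dasep_states n.
     (\<Sum>\<mu>\<in>dasep_states n. \<pi> \<mu> * dasep_rate n \<mu> \<nu>) =
     \<pi> \<nu> * (\<Sum>\<kappa>\<in>dasep_states n. dasep_rate n \<nu> \<kappa>))"
proof -
  let ?S = "dasep_states n" and ?r = "dasep_rate n"
  have "(\<Sum>\<mu>\<in>?S. \<pi> \<mu> * dasep_P n \<mu> \<nu>) = \<pi> \<nu> \<longleftrightarrow>
    (\<Sum>\<mu>\<in>?S. \<pi> \<mu> * ?r \<mu> \<nu>) = \<pi> \<nu> * (\<Sum>\<kappa>\<in>?S. ?r \<nu> \<kappa>)" if "\<nu> \<in> ?S" for \<nu>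
  proof -
    have "(\<Sum>\<mu>\<in>?S. \<pi> \<mu> * dasep_P n \<mu> \<nu>)
      = \<pi> \<nu> * dasep_P n \<nu> \<nu> + (\<Sum>\<mu>\<in>?S - {\<nu>}. \<pi> \<mu> * dasep_P n \<mu> \<nu>)"
      using that finite_dasep_states by (rule sum.remove[rotated])
    also have "(\<Sum>\<mu>\<in>?S - {\<nu>}. \<pi> \<mu> * dasep_P n \<mu> \<nu>) = (\<Sum>\<mu>\<in>?S - {\<nu>}. \<pi> \<mu> * ?r \<mu> \<nu>)"
      by (intro sum.cong) (auto simp: dasep_P_def)
    also have "dasep_P n \<nu> \<nu> = 1 - (\<Sum>\<kappa>\<in>?S - {\<nu>}. ?r \<nu> \<kappa>)"
      by (simp add: dasep_P_def)
    finally have 1: "(\<Sum>\<mu>\<in>?S. \<pi> \<mu> * dasep_P n \<mu> \<nu>)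
      = \<pi> \<nu> * (1 - (\<Sum>\<kappa>\<in>?S - {\<nu>}. ?r \<nu> \<kappa>)) + (\<Sum>\<mu>\<in>?S - {\<nu>}. \<pi> \<mu> * ?r \<mu> \<nu>)" .
    have 2: "(\<Sum>\<mu>\<in>?S. \<pi> \<mu> * ?r \<mu> \<nu>)
      = \<pi> \<nu> * ?r \<nu> \<nu> + (\<Sum>\<mu>\<in>?S - {\<nu>}. \<pi> \<mu> * ?r \<mu> \<nu>)"
      using that finite_dasep_states by (rule sum.remove[rotated])
    have 3: "(\<Sum>\<kappa>\<in>?S. ?r \<nu> \<kappa>) = ?r \<nu> \<nu> + (\<Sum>\<kappa>\<in>?S - {\<nu>}. ?r \<nu> \<kappa>)"
      using that finite_dasep_states by (rule sum.remove[rotated])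
    show ?thesis
      unfolding 1 2 3 by (auto simp: algebra_simps)
  qed
  then show ?thesis
    by (simp add: dasep_stationary_def)
qed

text \<open>Inflow and outflow are grouped by move and the factor \<open>1 / (3 n)\<close> is taken
  out. Each move has only one candidate predecessor of \<open>\<nu>\<close>. A swap reverses the
  order of the two entries, so inflow of rate 1 sits at the descents of \<open>\<nu>\<close> and
  inflow of rate \<open>t\<close> at its ascents.\<close>

lemma balance_if_local:
  assumes n: "2 \<le> n" and \<nu>: "\<nu> \<in> dasep_states n"
    and loc: "(\<Sum>k<n. if \<nu> ! k > \<nu> ! (Suc k mod n) then \<pi> (swap_next n k \<nu>) - var_t * \<pi> \<nu>
         else if \<nu> ! k < \<nu> ! (Suc k mod n) then var_t * \<pi> (swap_next n k \<nu>) - \<pi> \<nu> else 0)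
      + (\<Sum>k<n. if \<nu> ! k = 2 then var_u * \<pi> (\<nu>[k := 1]) - \<pi> \<nu>
         else if \<nu> ! k = 1 then \<pi> (\<nu>[k := 2]) - var_u * \<pi> \<nu> else 0) = 0"
  shows "(\<Sum>\<mu>\<in>dasep_states n. \<pi> \<mu> * dasep_rate n \<mu> \<nu>) =
     \<pi> \<nu> * (\<Sum>\<kappa>\<in>dasep_states n. dasep_rate n \<nu> \<kappa>)"
proof -
  let ?S = "dasep_states n" and ?c = "const_ut (1 / (3 * of_nat n))"
  let ?s = "\<lambda>k. swap_next n k \<nu>" and ?asc = "\<lambda>\<mu> k. \<mu> ! k < \<mu> ! (Suc k mod n)"
    and ?desc = "\<lambda>\<mu> k. \<mu> ! k > \<mu> ! (Suc k mod n)"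
  note fin = finite_dasep_states[of n]
  have len: "length \<mu> = n" if "\<mu> \<in> ?S" for \<mu>
    using that by (simp add: dasep_states_def)
  have swap_in: "?s k \<in> ?S" if "k < n" for k
    using swap_next_in_states[OF n that \<nu>] .
  have swap_nth: "?s k ! k = \<nu> ! (Suc k mod n)" "?s k ! (Suc k mod n) = \<nu> ! k" if "k < n" for k
    using n that Suc_mod_neq[of n k] by (simp_all add: nth_swap_next len[OF \<nu>])
  have swap_iff: "\<nu> = swap_next n k \<mu> \<longleftrightarrow> \<mu> = ?s k" if "k < n" "\<mu> \<in> ?S" for k \<mu>
    using swap_next_involution[OF n \<open>k < n\<close>] len \<nu> that by metis
  have in1: "(\<Sum>\<mu>\<in>?S. \<pi> \<mu> * (if ?asc \<mu> k \<and> \<nu> = swap_next n k \<mu> then z else 0)) =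
      (if ?desc \<nu> k then z * \<pi> (?s k) else 0)" if "k < n" for k z
  proof -
    have "(\<Sum>\<mu>\<in>?S. \<pi> \<mu> * (if ?asc \<mu> k \<and> \<nu> = swap_next n k \<mu> then z else 0)) =
      (\<Sum>\<mu>\<in>?S. if \<mu> = ?s k then (if ?desc \<nu> k then z * \<pi> (?s k) else 0) else 0)"
      using that swap_iff swap_nth by (intro sum.cong) auto
    then show ?thesis
      using fin swap_in[OF that] by simp
  qed
  have in2: "(\<Sum>\<mu>\<in>?S. \<pi> \<mu> * (if ?desc \<mu> k \<and> \<nu> = swap_next n k \<mu> then z else 0)) =
      (if ?asc \<nu> k then z * \<pi> (?s k) else 0)" if "k < n" for k z
  proof -
    have "(\<Sum>\<mu>\<in>?S. \<pi> \<mu> * (if ?desc \<mu> k \<and> \<nu> = swap_next n k \<mu> then z else 0)) =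
      (\<Sum>\<mu>\<in>?S. if \<mu> = ?s k then (if ?asc \<nu> k then z * \<pi> (?s k) else 0) else 0)"
      using that swap_iff swap_nth by (intro sum.cong) auto
    then show ?thesis
      using fin swap_in[OF that] by simp
  qed
  have in3: "(\<Sum>\<mu>\<in>?S. \<pi> \<mu> * (if \<mu> ! k = x \<and> \<nu> = \<mu>[k := y] then z else 0)) =
      (if \<nu> ! k = y then z * \<pi> (\<nu>[k := x]) else 0)"
    if "k < n" "x \<in> {1, 2}" "y \<in> {1, 2}" for k x y z
  proof -
    have iff: "\<mu> ! k = x \<and> \<nu> = \<mu>[k := y] \<longleftrightarrow> \<mu> = \<nu>[k := x] \<and> \<nu> ! k = y" if "\<mu> \<in> ?S" for \<mu>
      using \<open>k < n\<close> len[OF that] len[OF \<nu>]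
      by (metis list_update_id list_update_overwrite nth_list_update_eq)
    have "(\<Sum>\<mu>\<in>?S. \<pi> \<mu> * (if \<mu> ! k = x \<and> \<nu> = \<mu>[k := y] then z else 0)) =
      (\<Sum>\<mu>\<in>?S. if \<mu> = \<nu>[k := x] then (if \<nu> ! k = y then z * \<pi> (\<nu>[k := x]) else 0) else 0)"
      using iff by (intro sum.cong) auto
    moreover have "\<nu>[k := x] \<in> ?S" if "\<nu> ! k = y"
      using update_in_states[OF \<nu> \<open>k < n\<close>] \<open>x \<in> _\<close> \<open>y \<in> _\<close> that by auto
    ultimately show ?thesis
      using fin by auto
  qed
  have out1: "(\<Sum>\<kappa>\<in>?S. if Q \<and> \<kappa> = \<kappa>' then z else 0) = (if Q then z else 0)"
    if "Q \<Longrightarrow> \<kappa>' \<in> ?S" for Q \<kappa>' and z :: poly_ut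
    using fin that by (cases Q) auto
  have "(\<Sum>\<mu>\<in>?S. \<pi> \<mu> * dasep_rate n \<mu> \<nu>) =
      (\<Sum>k<n. if ?desc \<nu> k then ?c * \<pi> (?s k) else 0) +
      (\<Sum>k<n. if ?asc \<nu> k then ?c * var_t * \<pi> (?s k) else 0) +
      (\<Sum>k<n. if \<nu> ! k = 2 then ?c * var_u * \<pi> (\<nu>[k := 1]) else 0) +
      (\<Sum>k<n. if \<nu> ! k = 1 then ?c * \<pi> (\<nu>[k := 2]) else 0)"
    unfolding dasep_rate_def distrib_left sum_distrib_left sum.distrib
    by (intro arg_cong2[where f = "(+)"]; subst sum.swap; intro sum.cong refl;
        subst in1 in2 in3) auto
  moreover have "(\<Sum>\<kappa>\<in>?S. dasep_rate n \<nu> \<kappa>) =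
      (\<Sum>k<n. if ?asc \<nu> k then ?c else 0) +
      (\<Sum>k<n. if ?desc \<nu> k then ?c * var_t else 0) +
      (\<Sum>k<n. if \<nu> ! k = 1 then ?c * var_u else 0) +
      (\<Sum>k<n. if \<nu> ! k = 2 then ?c else 0)"
    unfolding dasep_rate_def sum.distrib
    by (intro arg_cong2[where f = "(+)"]; subst sum.swap; intro sum.cong refl;
        subst out1) (auto intro: swap_in update_in_states \<nu>)
  ultimately have "(\<Sum>\<mu>\<in>?S. \<pi> \<mu> * dasep_rate n \<mu> \<nu>) -
      \<pi> \<nu> * (\<Sum>\<kappa>\<in>?S. dasep_rate n \<nu> \<kappa>) =
      (\<Sum>k<n. (if ?desc \<nu> k then ?c * \<pi> (?s k) else 0) +
        (if ?asc \<nu> k then ?c * var_t * \<pi> (?s k) else 0) +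
        (if \<nu> ! k = 2 then ?c * var_u * \<pi> (\<nu>[k := 1]) else 0) +
        (if \<nu> ! k = 1 then ?c * \<pi> (\<nu>[k := 2]) else 0) -
        (\<pi> \<nu> * (if ?asc \<nu> k then ?c else 0) + \<pi> \<nu> * (if ?desc \<nu> k then ?c * var_t else 0) +
         \<pi> \<nu> * (if \<nu> ! k = 1 then ?c * var_u else 0) + \<pi> \<nu> * (if \<nu> ! k = 2 then ?c else 0)))"
    by (simp only: distrib_left sum_distrib_left sum.distrib sum_subtractf)
  also have "\<dots> = ?c * ((\<Sum>k<n. if ?desc \<nu> k then \<pi> (?s k) - var_t * \<pi> \<nu>
         else if ?asc \<nu> k then var_t * \<pi> (?s k) - \<pi> \<nu> else 0)
      + (\<Sum>k<n. if \<nu> ! k = 2 then var_u * \<pi> (\<nu>[k := 1]) - \<pi> \<nu>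
         else if \<nu> ! k = 1 then \<pi> (\<nu>[k := 2]) - var_u * \<pi> \<nu> else 0))"
    unfolding distrib_left sum_distrib_left sum.distrib[symmetric]
    by (intro sum.cong) (auto simp: algebra_simps)
  finally show ?thesis
    using loc by simp
qed

section \<open>Uniqueness of the stationary measure\<close>

text \<open>Zeros travel backward along transitions, so it suffices that every state can reach
  \<open>\<mu>\<^sub>0\<close>: turn each 2 into a 1, then bring the particles to sites 0 and
  1.\<close>

lemma dasep_stationary_eq_0:
  assumes n: "2 \<le> n" and x: "dasep_stationary n x"
    and base: "two_at n 0 1 1 1 \<mu>\<^sub>0" "x \<mu>\<^sub>0 = 0" and \<mu>: "\<mu> \<in> dasep_states n"
  shows "x \<mu> = 0"
proof -
  let ?S = "dasep_states n"
  have pull: "x \<mu> = 0" if "\<nu> \<in> ?S" "x \<nu> = 0" "\<mu> \<in> ?S" "dasep_rate n \<mu> \<nu> \<noteq> 0" for \<mu> \<nu>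
    using balance_zero_backward[where r = "dasep_rate n" and x = x,
        OF finite_dasep_states dasep_rate_nonneg _ that]
      x[unfolded dasep_stationary_iff_balance] by blast
  have move: "x \<mu> = 0" if "k < n" "\<mu> \<in> ?S" "\<mu> ! k \<noteq> \<mu> ! (Suc k mod n)" "x (swap_next n k \<mu>) = 0"
    for k \<mu>
    using pull[OF swap_next_in_states[OF n that(1,2)] that(4,2) dasep_rate_swap_neq_0[OF that(1,3)]] .
  have ones: "x \<mu> = 0" if "two_at n i 1 j 1 \<mu>" "i < j" for i j \<mu>
    using that
  \<comment> \<open>Each move lowers \<open>i + j\<close> by 1 and keeps \<open>i < j\<close>: the
    left particle goes down to site 0, then the right one to site 1, never across the wrap-around
    edge.\<close>
  proof (induction "i + j" arbitrary: i j \<mu> rule: less_induct)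
    case less
    note in_S = two_at_in_states[OF less.prems(1)]
    consider "i = 0" "j = 1" | "0 < i" | "i = 0" "1 < j"
      using less.prems by linarith
    then show ?case
    proof cases
      case 1
      then show ?thesis
        using less.prems base two_at_unique by blast
    next
      case 2
      define k where "k = i - 1"
      have k: "Suc k mod n = i" "k < n" "k \<noteq> j" "k \<noteq> i" "k < j" "k + j < i + j"
        using 2 less.prems by (auto simp: k_def two_at_def)
      have "x (swap_next n k \<mu>) = 0"
        using less.hyps[OF k(6) two_at_swap_backward[OF n less.prems(1) k(2,3,1)] k(5)] .
      then show ?thesis
        by (rule move[rotated -1]) (use k less.prems in_S in \<open>auto simp: two_at_def\<close>)
    next
      case 3
      define k where "k = j - 1"
      have k: "Suc k mod n = j" "k < n" "k \<noteq> i" "k \<noteq> j" "i < k" "i + k < i + j"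
        using 3 less.prems by (auto simp: k_def two_at_def)
      have "two_at n i 1 k 1 (swap_next n k \<mu>)"
        using two_at_swap_backward[OF n _ k(2,3,1)] less.prems(1) two_at_sym by blast
      then have "x (swap_next n k \<mu>) = 0"
        using less.hyps[OF k(6) _ k(5)] by blast
      then show ?thesis
        by (rule move[rotated -1]) (use k less.prems in_S in \<open>auto simp: two_at_def\<close>)
    qed
  qed
  have ones': "x \<mu> = 0" if "two_at n i 1 j 1 \<mu>" for i j \<mu>
    using that ones two_at_sym by (metis linorder_neqE_nat two_at_def)
  \<comment> \<open>Handles one particle: a 2 at \<open>i\<close> becomes a 1 in one transition. It
    is applied to each of the two particles in turn.\<close>
  have raise: "x \<mu> = 0" if "two_at n i z j y \<mu>" "z \<in> {1, 2}" "y \<in> {1, 2}"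
    "\<And>\<nu>. two_at n i 1 j y \<nu> \<Longrightarrow> x \<nu> = 0" for i j y z \<mu>
  proof (cases "z = 1")
    case True
    then show ?thesis
      using that by blast
  next
    case False
    then have z: "\<mu> ! i = 3 - 1" "i < n"
      using that by (auto simp: two_at_def)
    have "two_at n i 1 j y (\<mu>[i := 1])"
      using two_at_update[OF that(1)] .
    then show ?thesis
      using pull[of "\<mu>[i := 1]" \<mu>] dasep_rate_update_neq_0[OF z(2) _ z(1)] that two_at_in_states
      by blast
  qed
  obtain i z j y where \<mu>: "two_at n i z j y \<mu>" "z \<in> {1, 2}" "y \<in> {1, 2}"
    using \<mu> dasep_states_two_at by blast
  show ?thesis
  proof (rule raise[OF \<mu>])
    fix \<nu> assume "two_at n i 1 j y \<nu>"
    then have "two_at n j y i 1 \<nu>"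
      using two_at_sym by blast
    then show "x \<nu> = 0"
      using raise[of j y i 1 \<nu>] ones' \<mu>(3) by blast
  qed
qed

text \<open>The difference of the two sides is stationary in \<open>\<mu>\<close> by linearity and
  vanishes at \<open>\<mu>\<^sub>0\<close>. The cross-multiplied form stays inside the polynomial
  ring.\<close>

lemma dasep_stationary_proportional:
  assumes n: "2 \<le> n" and x: "dasep_stationary n x" and y: "dasep_stationary n y"
    and base: "two_at n 0 1 1 1 \<mu>\<^sub>0" and \<mu>: "\<mu> \<in> dasep_states n"
  shows "x \<mu> * y \<mu>\<^sub>0 = x \<mu>\<^sub>0 * y \<mu>"
proof -
  have "dasep_stationary n (\<lambda>\<mu>. x \<mu> * y \<mu>\<^sub>0 - x \<mu>\<^sub>0 * y \<mu>)"
    unfolding dasep_stationary_def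
  proof
    fix \<nu> assume "\<nu> \<in> dasep_states n"
    then have "(\<Sum>\<mu>\<in>dasep_states n. x \<mu> * dasep_P n \<mu> \<nu>) = x \<nu>"
      "(\<Sum>\<mu>\<in>dasep_states n. y \<mu> * dasep_P n \<mu> \<nu>) = y \<nu>"
      using x y by (auto simp: dasep_stationary_def)
    moreover have "(\<Sum>\<mu>\<in>dasep_states n. (x \<mu> * y \<mu>\<^sub>0 - x \<mu>\<^sub>0 * y \<mu>) * dasep_P n \<mu> \<nu>) =
        y \<mu>\<^sub>0 * (\<Sum>\<mu>\<in>dasep_states n. x \<mu> * dasep_P n \<mu> \<nu>)
        - x \<mu>\<^sub>0 * (\<Sum>\<mu>\<in>dasep_states n. y \<mu> * dasep_P n \<mu> \<nu>)"
      by (simp add: sum_distrib_left sum_subtractf[symmetric] algebra_simps)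
    ultimately show "(\<Sum>\<mu>\<in>dasep_states n. (x \<mu> * y \<mu>\<^sub>0 - x \<mu>\<^sub>0 * y \<mu>) * dasep_P n \<mu> \<nu>)
        = x \<nu> * y \<mu>\<^sub>0 - x \<mu>\<^sub>0 * y \<nu>"
      by (simp add: mult.commute)
  qed
  from dasep_stationary_eq_0[OF n this base _ \<mu>] show ?thesis
    by simp
qed

lemma is_unit_const_ut: "is_unit (p :: poly_ut) \<Longrightarrow> \<exists>c. c \<noteq> 0 \<and> p = const_ut c"
  by (auto simp: is_unit_poly_iff const_ut_def)

text \<open>The family \<open>x\<close> scaled by \<open>y \<mu>\<^sub>0\<close> equals the family
  \<open>y\<close> scaled by \<open>x \<mu>\<^sub>0\<close>. Both families have gcd 1, so the
  scalars are associated, and units of \<open>poly_ut\<close> are nonzero rational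
  constants.\<close>

lemma dasep_unnormalized_unique:
  assumes n: "2 \<le> n" and x: "dasep_unnormalized n x" and y: "dasep_unnormalized n y"
    and base: "two_at n 0 1 1 1 \<mu>\<^sub>0" "y \<mu>\<^sub>0 \<noteq> 0"
  shows "\<exists>c. c \<noteq> 0 \<and> (\<forall>\<mu>\<in>dasep_states n. x \<mu> = const_ut c * y \<mu>)"
proof -
  let ?S = "dasep_states n"
  have cross: "y \<mu>\<^sub>0 * x \<mu> = x \<mu>\<^sub>0 * y \<mu>" if "\<mu> \<in> ?S" for \<mu>
    using dasep_stationary_proportional[OF n _ _ base(1) that] x y
    by (simp add: dasep_unnormalized_def mult.commute)
  have "(*) (y \<mu>\<^sub>0) ` (x ` ?S) = (*) (x \<mu>\<^sub>0) ` (y ` ?S)"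
    using cross by (force simp: image_image intro: image_cong)
  then have "Gcd ((*) (y \<mu>\<^sub>0) ` (x ` ?S)) = Gcd ((*) (x \<mu>\<^sub>0) ` (y ` ?S))"
    by (rule arg_cong)
  then have "normalize (y \<mu>\<^sub>0) = normalize (x \<mu>\<^sub>0)"
    using x y by (simp add: Gcd_mult dasep_unnormalized_def)
  then obtain v where v: "is_unit v" "x \<mu>\<^sub>0 = v * y \<mu>\<^sub>0"
    by (metis associatedE1)
  then obtain c where c: "c \<noteq> 0" "v = const_ut c"
    using is_unit_const_ut by blast
  have "x \<mu> = const_ut c * y \<mu>" if "\<mu> \<in> ?S" for \<mu>
    using cross[OF that] base(2) v c by simp
  with c show ?thesis
    by blast
qed

section \<open>The weights and their balance\<close>

definition cdist :: "nat \<Rightarrow> nat \<Rightarrow> nat \<Rightarrow> nat" where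
  "cdist n i j = (j + n - i) mod n"

lemma cdist_eq: "i < n \<Longrightarrow> j < n \<Longrightarrow> cdist n i j = (if i \<le> j then j - i else j + n - i)"
  by (auto simp: cdist_def mod_if)

lemma Suc_mod_eq: "k < n \<Longrightarrow> Suc k mod n = (if Suc k = n then 0 else Suc k)"
  by auto

lemma cdist_bounds: "i < n \<Longrightarrow> j < n \<Longrightarrow> i \<noteq> j \<Longrightarrow> 0 < cdist n i j \<and> cdist n i j < n"
  by (auto simp: cdist_eq)

lemma cdist_swap: "i < n \<Longrightarrow> j < n \<Longrightarrow> i \<noteq> j \<Longrightarrow> cdist n j i = n - cdist n i j"
  by (auto simp: cdist_eq)

lemma cdist_Suc_left:
  "i < n \<Longrightarrow> j < n \<Longrightarrow> i \<noteq> j \<Longrightarrow> cdist n i j = Suc (cdist n (Suc i mod n) j)"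
  by (auto simp: cdist_eq Suc_mod_eq)

lemma cdist_Suc_right:
  "i < n \<Longrightarrow> j < n \<Longrightarrow> Suc j mod n \<noteq> i \<Longrightarrow> cdist n i (Suc j mod n) = Suc (cdist n i j)"
  by (auto simp: cdist_eq Suc_mod_eq split: if_splits)

lemma cdist_1_iff: "i < n \<Longrightarrow> j < n \<Longrightarrow> i \<noteq> j \<Longrightarrow> cdist n i j = 1 \<longleftrightarrow> Suc i mod n = j"
  by (auto simp: cdist_eq Suc_mod_eq split: if_splits)

lemma cyclic_pred_ex:
  assumes "i < n" obtains k where "k < n" "Suc k mod n = i"
proof (cases i)
  case 0
  with assms show thesis
    by (intro that[of "n - 1"]) auto
next
  case (Suc k)
  with assms show thesis
    by (intro that[of k]) auto
qed

lemma Suc_mod_inj: "k < n \<Longrightarrow> l < n \<Longrightarrow> Suc k mod n = Suc l mod n \<Longrightarrow> k = l"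
  by (auto simp: Suc_mod_eq split: if_splits)

section \<open>Weights of two-particle states\<close>

definition pair_weight :: "poly_ut \<Rightarrow> (nat \<Rightarrow> poly_ut) \<Rightarrow> nat \<Rightarrow> nat \<Rightarrow> nat \<Rightarrow> poly_ut" where
  "pair_weight A H x y d =
     A * (if x = 2 then var_u else 1) * (if y = 2 then var_u else 1) +
     (if x = 1 \<and> y = 2 then var_u * (var_t - 1) * H d
      else if x = 2 \<and> y = 1 then - (var_u * (var_t - 1) * H d) else 0)"

text \<open>A formula on whole lists avoids choosing positions. On a two-particle state the double
  sum has a single term if the species differ and none otherwise.\<close>

definition dasep_weight :: "nat \<Rightarrow> poly_ut \<Rightarrow> (nat \<Rightarrow> poly_ut) \<Rightarrow> nat list \<Rightarrow> poly_ut" where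
  "dasep_weight n A H \<mu> =
     A * (\<Prod>k<n. if \<mu> ! k = 2 then var_u else 1) +
     (\<Sum>i<n. \<Sum>j<n. if \<mu> ! i = 1 \<and> \<mu> ! j = 2 then var_u * (var_t - 1) * H (cdist n i j) else 0)"

text \<open>The double sum measures from the 1 to the 2. If the 2 is listed first, this is
  \<open>n\<close> minus the listed distance, and antisymmetry of \<open>H\<close> gives the minus
  sign in \<open>pair_weight\<close>.\<close>

lemma dasep_weight_two_at:
  assumes H: "\<And>d. 0 < d \<Longrightarrow> d < n \<Longrightarrow> H (n - d) = - H d"
    and \<mu>: "two_at n i x j y \<mu>" and x: "x \<in> {1, 2}" and y: "y \<in> {1, 2}"
  shows "dasep_weight n A H \<mu> = pair_weight A H x y (cdist n i j)"
proof -
  have ij: "i < n" "j < n" "i \<noteq> j" and nth: "\<mu> ! i = x" "\<mu> ! j = y"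
    and zero: "\<And>k. k < n \<Longrightarrow> k \<noteq> i \<Longrightarrow> k \<noteq> j \<Longrightarrow> \<mu> ! k = 0"
    using \<mu> by (auto simp: two_at_def)
  have "(\<Prod>k<n. if \<mu> ! k = 2 then var_u else 1) = (\<Prod>k\<in>{i, j}. if \<mu> ! k = 2 then var_u else 1)"
    using ij zero by (intro prod.mono_neutral_right) auto
  then have 1: "(\<Prod>k<n. if \<mu> ! k = 2 then var_u else 1) =
      (if x = 2 then var_u else 1) * (if y = 2 then var_u else 1)"
    using ij nth by simp
  define g where "g p q = (if \<mu> ! p = 1 \<and> \<mu> ! q = 2
      then var_u * (var_t - 1) * H (cdist n p q) else 0)" for p q
  have "(\<Sum>p<n. \<Sum>q<n. g p q) = (\<Sum>p\<in>{i, j}. \<Sum>q<n. g p q)"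
    using ij zero by (intro sum.mono_neutral_right) (auto simp: g_def)
  also have "\<dots> = (\<Sum>p\<in>{i, j}. \<Sum>q\<in>{i, j}. g p q)"
    using ij zero by (intro sum.cong refl sum.mono_neutral_right) (auto simp: g_def)
  also have "\<dots> = (g i i + g i j) + (g j i + g j j)"
    using ij by simp
  also have "\<dots> = (if x = 1 \<and> y = 2 then var_u * (var_t - 1) * H (cdist n i j)
      else if x = 2 \<and> y = 1 then - (var_u * (var_t - 1) * H (cdist n i j)) else 0)"
    using x y nth ij H[of "cdist n i j"] cdist_bounds[of i n j]
    by (auto simp: g_def cdist_swap[of i n j])
  finally show ?thesis
    unfolding dasep_weight_def pair_weight_def 1 g_def by (simp add: mult.assoc)
qed

text \<open>The four swaps next to two non-adjacent particles, followed by the two changes of species.\<close>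

lemma pair_weight_simps:
  "pair_weight A H 1 1 d = A"
  "pair_weight A H 1 2 d = A * var_u + var_u * (var_t - 1) * H d"
  "pair_weight A H 2 1 d = A * var_u - var_u * (var_t - 1) * H d"
  "pair_weight A H 2 2 d = A * var_u * var_u"
  by (simp_all add: pair_weight_def)

text \<open>The \<open>A\<close> terms cancel. For equal species so do the \<open>H\<close> terms;
  for a mixed pair what remains is, up to sign, \<open>var_u * (var_t - 1)\<close> times the defect
  of the recurrence.\<close>

lemma pair_weight_balance:
  fixes A :: poly_ut
  assumes x: "x \<in> {1, 2}" and y: "y \<in> {1, 2}"
    and H: "(var_t + 1) * (H (d - 1) + H (d + 1)) = (var_u + 2 * var_t + 3) * H d"
  defines "W \<equiv> pair_weight A H"
  shows "(var_t * W x y (d + 1) - W x y d) + (W x y (d - 1) - var_t * W x y d)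
    + (var_t * W x y (d - 1) - W x y d) + (W x y (d + 1) - var_t * W x y d)
    + (if x = 2 then var_u * W 1 y d - W x y d else W 2 y d - var_u * W x y d)
    + (if y = 2 then var_u * W x 1 d - W x y d else W x 2 d - var_u * W x y d) = 0"
    (is "?lhs = 0")
proof -
  let ?D = "var_u * (var_t - 1) * ((var_t + 1) * (H (d - 1) + H (d + 1)) - (var_u + 2 * var_t + 3) * H d)"
  note W = pair_weight_simps[of A H, folded W_def]
  have D: "?D = 0"
    unfolding H by simp
  consider "x = 1" "y = 1" | "x = 1" "y = 2" | "x = 2" "y = 1" | "x = 2" "y = 2"
    using x y by blast
  then show ?thesis
  proof cases
    case 1
    show ?thesis
      unfolding 1 W by (simp add: W algebra_simps)
  next
    case 2
    have "?lhs = ?D"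
      unfolding 2 W by (simp add: W algebra_simps)
    then show ?thesis
      unfolding D .
  next
    case 3
    have "?lhs = - ?D"
      unfolding 3 W by (simp add: W algebra_simps)
    then show ?thesis
      unfolding D by simp
  next
    case 4
    show ?thesis
      unfolding 4 W by (simp add: W algebra_simps)
  qed
qed

text \<open>For a mixed pair, the exchange of neighbours leaves
  \<open>var_u * (var_t - 1) * A\<close> up to sign. This puts \<open>A\<close> into the boundary
  equation and explains the prefactor of \<open>H\<close>.\<close>

lemma pair_weight_balance_adjacent:
  fixes A :: poly_ut
  assumes x: "x \<in> {1, 2}" and y: "y \<in> {1, 2}"
    and H: "A + (var_t + 1) * H 2 = (var_u + 2 * var_t + 3) * H 1"
  defines "W \<equiv> pair_weight A H"
  shows "(var_t * W x y 2 - W x y 1) + (W x y 2 - var_t * W x y 1)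
    + (if x > y then W y x 1 - var_t * W x y 1
       else if x < y then var_t * W y x 1 - W x y 1 else 0)
    + (if x = 2 then var_u * W 1 y 1 - W x y 1 else W 2 y 1 - var_u * W x y 1)
    + (if y = 2 then var_u * W x 1 1 - W x y 1 else W x 2 1 - var_u * W x y 1) = 0"
    (is "?lhs = 0")
proof -
  let ?D = "var_u * (var_t - 1) * (A + (var_t + 1) * H 2 - (var_u + 2 * var_t + 3) * H 1)"
  note W = pair_weight_simps[of A H, folded W_def]
  have D: "?D = 0"
    unfolding H by simp
  consider "x = 1" "y = 1" | "x = 1" "y = 2" | "x = 2" "y = 1" | "x = 2" "y = 2"
    using x y by blast
  then show ?thesis
  proof cases
    case 1
    show ?thesis
      unfolding 1 W by (simp add: W algebra_simps)
  next
    case 2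
    have "?lhs = ?D"
      unfolding 2 W by (simp add: W algebra_simps)
    then show ?thesis
      unfolding D .
  next
    case 3
    have "?lhs = - ?D"
      unfolding 3 W by (simp add: W algebra_simps)
    then show ?thesis
      unfolding D by simp
  next
    case 4
    show ?thesis
      unfolding 4 W by (simp add: W algebra_simps)
  qed
qed

text \<open>Listing the particles so that their distance is at most \<open>n / 2\<close> makes the
  recurrence on that half sufficient.\<close>

lemma dasep_weight_stationary:
  assumes n: "3 \<le> n"
    and anti: "\<And>d. 0 < d \<Longrightarrow> d < n \<Longrightarrow> H (n - d) = - H d"
    and first: "A + (var_t + 1) * H 2 = (var_u + 2 * var_t + 3) * H 1"
    and step: "\<And>d. 2 \<le> d \<Longrightarrow> 2 * d \<le> n \<Longrightarrow>
      (var_t + 1) * (H (d - 1) + H (d + 1)) = (var_u + 2 * var_t + 3) * H d"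
  shows "dasep_stationary n (dasep_weight n A H)"
  unfolding dasep_stationary_iff_balance
proof
  fix \<nu> assume \<nu>: "\<nu> \<in> dasep_states n"
  let ?w = "dasep_weight n A H" and ?W = "pair_weight A H"
  have w: "?w \<mu> = ?W x y (cdist n i j)"
    if "two_at n i x j y \<mu>" "x \<in> {1, 2}" "y \<in> {1, 2}" for i x j y \<mu>
    using anti that by (rule dasep_weight_two_at)
  have n2: "2 \<le> n"
    using n by simp
  obtain i x j y where at: "two_at n i x j y \<nu>" and x: "x \<in> {1, 2}" and y: "y \<in> {1, 2}"
    and near: "2 * cdist n i j \<le> n"
  proof -
    obtain i x j y where *: "two_at n i x j y \<nu>" "x \<in> {1, 2}" "y \<in> {1, 2}"
      using \<nu> dasep_states_two_at by blast
    then have "cdist n j i = n - cdist n i j"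
      by (intro cdist_swap) (auto simp: two_at_def)
    then have "2 * cdist n i j \<le> n \<or> 2 * cdist n j i \<le> n"
      by linarith
    with * that show thesis
      using two_at_sym by blast
  qed
  define d where "d = cdist n i j"
  have at': "two_at n j y i x \<nu>"
    using at two_at_sym by blast
  have ij: "i < n" "j < n" "i \<noteq> j" and nth: "\<nu> ! i = x" "\<nu> ! j = y"
    and zero: "\<And>k. k < n \<Longrightarrow> k \<noteq> i \<Longrightarrow> k \<noteq> j \<Longrightarrow> \<nu> ! k = 0"
    using at by (auto simp: two_at_def)
  have xy: "0 < x" "0 < y"
    using x y by auto
  \<comment> \<open>With \<open>p\<close> and \<open>q\<close> just before \<open>i\<close> and
    \<open>j\<close>, the edges touching a particle are those starting at \<open>p\<close>,
    \<open>i\<close>, \<open>q\<close> and \<open>j\<close>.\<close>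
  obtain p where p: "p < n" "Suc p mod n = i"
    using cyclic_pred_ex ij by blast
  obtain q where q: "q < n" "Suc q mod n = j"
    using cyclic_pred_ex ij by blast
  have d: "0 < d" "2 * d \<le> n"
    using near cdist_bounds[OF ij] by (auto simp: d_def)
  \<comment> \<open>Otherwise \<open>d = n - 1\<close>, which contradicts
    \<open>2 * d \<le> n\<close> for \<open>n \<ge> 3\<close>.\<close>
  have pj: "p \<noteq> j"
  proof
    assume "p = j"
    then have "cdist n j i = 1"
      using cdist_1_iff[of j n i] ij p by simp
    then show False
      using cdist_swap[OF ij] d n by (simp add: d_def)
  qed
  have sj: "Suc j mod n \<noteq> i"
    using pj Suc_mod_inj[of j n p] p ij by auto
  have w\<nu>: "?w \<nu> = ?W x y d"
    using w[OF at x y] by (simp add: d_def)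
  define E where "E k = (if \<nu> ! k > \<nu> ! (Suc k mod n) then ?w (swap_next n k \<nu>) - var_t * ?w \<nu>
      else if \<nu> ! k < \<nu> ! (Suc k mod n) then var_t * ?w (swap_next n k \<nu>) - ?w \<nu> else 0)" for k
  define F where "F k = (if \<nu> ! k = 2 then var_u * ?w (\<nu>[k := 1]) - ?w \<nu>
         else if \<nu> ! k = 1 then ?w (\<nu>[k := 2]) - var_u * ?w \<nu> else 0)" for k
  have "sum F {..<n} = sum F {i, j}"
    using ij zero by (intro sum.mono_neutral_right) (auto simp: F_def)
  moreover have "F i = (if x = 2 then var_u * ?W 1 y d - ?W x y d else ?W 2 y d - var_u * ?W x y d)"
    using x w[OF two_at_update[OF at, of 1] _ y] w[OF two_at_update[OF at, of 2] _ y]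
    by (auto simp: F_def nth w\<nu> d_def)
  moreover have "F j = (if y = 2 then var_u * ?W x 1 d - ?W x y d else ?W x 2 d - var_u * ?W x y d)"
    using y w[OF two_at_update[OF at', of 1, THEN two_at_sym[THEN iffD1]] x]
      w[OF two_at_update[OF at', of 2, THEN two_at_sym[THEN iffD1]] x]
    by (auto simp: F_def nth w\<nu> d_def)
  ultimately have F: "sum F {..<n} =
      (if x = 2 then var_u * ?W 1 y d - ?W x y d else ?W 2 y d - var_u * ?W x y d) +
      (if y = 2 then var_u * ?W x 1 d - ?W x y d else ?W x 2 d - var_u * ?W x y d)"
    using ij by simp
  have E_sum: "sum E {..<n} = sum E {p, i, q, j}"
  proof (rule sum.mono_neutral_right)
    show "\<forall>k\<in>{..<n} - {p, i, q, j}. E k = 0"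
    proof
      fix k assume k: "k \<in> {..<n} - {p, i, q, j}"
      then have "Suc k mod n \<noteq> i" "Suc k mod n \<noteq> j"
        using Suc_mod_inj[of k n p] Suc_mod_inj[of k n q] p q by auto
      with k zero[of "Suc k mod n"] zero[of k] n show "E k = 0"
        by (simp add: E_def)
    qed
  qed (use p q ij in auto)
  have "cdist n p j = d + 1"
    using cdist_Suc_left[OF p(1) ij(2) pj] p by (simp add: d_def)
  then have "?w (swap_next n p \<nu>) = ?W x y (d + 1)"
    using w[OF two_at_swap_backward[OF n2 at p(1) pj p(2)] x y] by simp
  moreover have "\<nu> ! p = 0"
    using zero[of p] p pj Suc_mod_neq[OF n2, of p] by auto
  ultimately have Ep: "E p = var_t * ?W x y (d + 1) - ?W x y d"
    using xy by (simp add: E_def p nth w\<nu>)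
  have "cdist n i (Suc j mod n) = d + 1"
    using cdist_Suc_right[OF ij(1,2) sj] by (simp add: d_def)
  moreover have "two_at n i x (Suc j mod n) y (swap_next n j \<nu>)"
    using two_at_swap_forward[OF n2 at' sj] two_at_sym by blast
  ultimately have "?w (swap_next n j \<nu>) = ?W x y (d + 1)"
    using w[OF _ x y] by metis
  moreover have "\<nu> ! (Suc j mod n) = 0"
    using zero[of "Suc j mod n"] sj Suc_mod_neq[OF n2 ij(2)] ij by auto
  ultimately have Ej: "E j = ?W x y (d + 1) - var_t * ?W x y d"
    using xy by (simp add: E_def nth w\<nu>)
  have neq: "p \<noteq> i" "q \<noteq> j" "p \<noteq> q"
    using Suc_mod_neq[OF n2, of p] Suc_mod_neq[OF n2, of q] p q ij by auto
  have "sum E {..<n} + sum F {..<n} = 0"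
  proof (cases "d = 1")
    case True
    then have si: "Suc i mod n = j"
      using cdist_1_iff[OF ij] by (simp add: d_def)
    \<comment> \<open>Adjacent particles share an edge, so only three edges contribute.\<close>
    then have qi: "q = i"
      using Suc_mod_inj[of q n i] q ij by auto
    have "?w (swap_next n i \<nu>) = ?W y x 1"
      using w[OF two_at_swap_adjacent[OF n2 at si] y x] True by (simp add: d_def)
    then have Ei: "E i = (if x > y then ?W y x 1 - var_t * ?W x y 1
       else if x < y then var_t * ?W y x 1 - ?W x y 1 else 0)"
      by (simp add: E_def nth si w\<nu> True)
    have "sum E {p, i, q, j} = E p + E i + E j"
      using neq pj ij qi by simp
    then show ?thesis
      using pair_weight_balance_adjacent[of x y A H, OF x y first]
      unfolding E_sum F Ep Ej Ei True by (simp add: numeral_2_eq_2 algebra_simps)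
  next
    case False
    then have si: "Suc i mod n \<noteq> j" and d2: "2 \<le> d"
      using cdist_1_iff[OF ij] d by (auto simp: d_def)
    then have qi: "q \<noteq> i"
      using q by auto
    have "cdist n (Suc i mod n) j = d - 1"
      using cdist_Suc_left[OF ij] by (simp add: d_def)
    then have "?w (swap_next n i \<nu>) = ?W x y (d - 1)"
      using w[OF two_at_swap_forward[OF n2 at si] x y] by simp
    moreover have "\<nu> ! (Suc i mod n) = 0"
      using zero[of "Suc i mod n"] si Suc_mod_neq[OF n2 ij(1)] ij by auto
    ultimately have Ei: "E i = ?W x y (d - 1) - var_t * ?W x y d"
      using xy by (simp add: E_def nth w\<nu>)
    have "cdist n i q = d - 1"
      using cdist_Suc_right[OF ij(1) q(1)] q ij by (simp add: d_def)
    moreover have "two_at n i x q y (swap_next n q \<nu>)"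
      using two_at_swap_backward[OF n2 at' q(1) qi q(2)] two_at_sym by blast
    ultimately have "?w (swap_next n q \<nu>) = ?W x y (d - 1)"
      using w[OF _ x y] by metis
    moreover have "\<nu> ! q = 0"
      using zero[of q] q qi neq by auto
    ultimately have Eq: "E q = var_t * ?W x y (d - 1) - ?W x y d"
      using xy by (simp add: E_def q nth w\<nu>)
    have "sum E {p, i, q, j} = E p + E i + E q + E j"
      using neq pj ij qi by (simp add: add.assoc)
    then show ?thesis
      using pair_weight_balance[of x y H d A, OF x y step[OF d2 d(2)]]
      unfolding E_sum F Ep Ej Ei Eq by (simp add: algebra_simps)
  qed
  then show "(\<Sum>\<mu>\<in>dasep_states n. ?w \<mu> * dasep_rate n \<mu> \<nu>) =
      ?w \<nu> * (\<Sum>\<kappa>\<in>dasep_states n. dasep_rate n \<nu> \<kappa>)"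
    unfolding E_def F_def by (rule balance_if_local[OF n2 \<nu>])
qed

section \<open>The recurrent sequences\<close>

text \<open>The growth bound absorbs the subtracted term. The parameter \<open>v\<close> is
  \<open>var_u\<close> in one application and 0 in the other.\<close>

lemma recurrence_pos:
  fixes c :: "nat \<Rightarrow> 'a :: linordered_idom"
  assumes "0 \<le> v" "0 \<le> t" "0 < c 1" "(t + 1) * c 0 \<le> c 1"
    and rec: "\<And>k. c (k + 2) = (v + 2 * t + 3) * c (k + 1) - (t + 1)\<^sup>2 * c k"
  shows "0 < c (Suc k) \<and> (t + 1) * c k \<le> c (Suc k)"
proof (induction k)
  case 0
  then show ?case
    using assms by simp
next
  case (Suc k)
  have "(t + 1) * ((t + 1) * c k) \<le> (t + 1) * c (Suc k)"
    using Suc \<open>0 \<le> t\<close> by (intro mult_left_mono) auto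
  moreover have "c (Suc (Suc k)) = (t + 1) * c (Suc k) + (v + 1) * c (Suc k)
      + ((t + 1) * c (Suc k) - (t + 1) * ((t + 1) * c k))"
    using rec[of k] by (simp add: algebra_simps power2_eq_square)
  moreover have "0 < (v + 1) * c (Suc k)" "0 < (t + 1) * c (Suc k)"
    using Suc assms by (auto intro!: mult_pos_pos)
  ultimately show ?case
    by linarith
qed

text \<open>The degree bound makes the subtracted term too small to affect the leading term, which
  comes from \<open>[:p, 1:] * c (k + 1)\<close>.\<close>

lemma recurrence_monic:
  fixes c :: "nat \<Rightarrow> 'a :: idom poly"
  assumes "lead_coeff (c 1) = 1" "degree (c 0) \<le> degree (c 1)"
    and rec: "\<And>k. c (k + 2) = [:p, 1:] * c (k + 1) - [:q:] * c k"
  shows "lead_coeff (c (Suc k)) = 1 \<and> degree (c k) \<le> degree (c (Suc k))"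
proof (induction k)
  case 0
  then show ?case
    using assms by simp
next
  case (Suc k)
  let ?f = "[:p, 1:] * c (Suc k)" and ?g = "- ([:q:] * c k)"
  have "c (Suc k) \<noteq> 0"
    using Suc by auto
  then have deg: "degree ?f = Suc (degree (c (Suc k)))"
    by (subst degree_mult_eq) auto
  have lead: "lead_coeff ?f = 1"
    unfolding lead_coeff_mult using Suc by simp
  have "degree ?g < degree ?f"
    unfolding deg using Suc degree_smult_le[of q "c k"] by simp
  then have "degree (?f + ?g) = degree ?f" "lead_coeff (?f + ?g) = lead_coeff ?f"
    using degree_add_eq_left[of ?g ?f] lead_coeff_add_le[of ?g ?f]
    by (simp_all add: coeff_eq_0)
  moreover have "c (Suc (Suc k)) = ?f + ?g"
    using rec[of k] by simp
  ultimately show ?case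
    using deg lead by simp
qed

text \<open>Modulo \<open>f\<close> the indeterminate divides the nonzero constant \<open>f(0)\<close>, so a common divisor is a
  constant.\<close>

lemma common_divisor_monic_is_unit:
  fixes f :: "'a :: idom poly"
  assumes "lead_coeff f = 1" "poly f 0 \<noteq> 0" "g dvd f" "g dvd [:0, 1:] * [:p:]" "p \<noteq> 0"
  shows "g dvd 1"
proof -
  obtain r q where f: "f = pCons r q"
    by (cases f)
  then have r: "r \<noteq> 0"
    using assms by simp
  have "g dvd f * [:p:] - q * ([:0, 1:] * [:p:])"
    using assms(3,4) by (intro dvd_diff dvd_mult2[of g f] dvd_mult[of g _ q])
  also have "\<dots> = [:r * p:]"
    by (simp add: f)
  finally have "degree g \<le> degree [:r * p:]"
    using r assms by (intro dvd_imp_degree_le) auto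
  then obtain s where s: "g = [:s:]"
    by (auto elim: degree_eq_zeroE)
  then have "s dvd lead_coeff f"
    using assms const_poly_dvd_iff by blast
  then show ?thesis
    using assms by (simp add: s is_unit_const_poly_iff)
qed

text \<open>Treats both parities at once. For even \<open>n\<close> the sequence starts one index
  before \<open>b 0\<close>, hence \<open>c 0 = 0\<close>.\<close>

locale dasep_profile =
  fixes n N :: nat and c :: "nat \<Rightarrow> poly_ut"
  assumes n_ge_3: "3 \<le> n"
    and rec: "\<And>k. c (k + 2) = (var_u + 2 * var_t + 3) * c (k + 1) - (var_t + 1)\<^sup>2 * c k"
    and initial: "n = 2 * N + 1 \<and> c 0 = 1 \<and> c 1 = var_u + 3 * var_t + 4 \<or>
      n = 2 * N \<and> c 0 = 0 \<and> c 1 = 1"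
begin

text \<open>The second branch extends \<open>H\<close> antisymmetrically past the antipode. For even
  \<open>n\<close>, antisymmetry forces \<open>H N = 0\<close>, which holds since
  \<open>c 0 = 0\<close>.\<close>

definition H :: "nat \<Rightarrow> poly_ut" where
  "H d = (if d \<le> N then (var_t + 1) ^ (d - 1) * c (N - d)
          else - ((var_t + 1) ^ (n - d - 1) * c (N - (n - d))))"

abbreviation weight :: "nat list \<Rightarrow> poly_ut" where
  "weight \<equiv> dasep_weight n (c N) H"

lemma N_pos: "1 \<le> N"
  using initial n_ge_3 by linarith

lemma H_anti: "0 < d \<Longrightarrow> d < n \<Longrightarrow> H (n - d) = - H d"
  using initial by (auto simp: H_def)

lemma H_step:
  assumes "2 \<le> d" "2 * d \<le> n"
  shows "(var_t + 1) * (H (d - 1) + H (d + 1)) = (var_u + 2 * var_t + 3) * H d"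
proof -
  define e where "e = d - 2"
  have d: "d = Suc (Suc e)"
    using assms by (simp add: e_def)
  have dN: "d \<le> N"
    using assms initial by linarith
  show ?thesis
  proof (cases "d = N")
    case False
    define r where "r = N - d - 1"
    have N: "N = d + r + 1"
      using dN False by (simp add: r_def)
    then have "N - (d - 1) = r + 2" "N - d = r + 1" "N - (d + 1) = r" "d + 1 \<le> N"
      using d by auto
    then have "H (d - 1) = (var_t + 1) ^ e * c (r + 2)" "H d = (var_t + 1) ^ Suc e * c (r + 1)"
      "H (d + 1) = (var_t + 1) ^ Suc (Suc e) * c r"
      using d dN by (auto simp: H_def simp del: add_2_eq_Suc')
    then show ?thesis
      unfolding rec by (simp add: algebra_simps power2_eq_square)
  next
    case True
    \<comment> \<open>At the antipode the recurrence of \<open>c\<close> is replaced by its initial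
      values. For even \<open>n\<close> both sides vanish; for odd \<open>n\<close>,
      \<open>H (N + 1) = - H N\<close> turns the equation into
      \<open>c 1 = var_u + 3 * var_t + 4\<close>.\<close>
    then have "H (d - 1) = (var_t + 1) ^ e * c 1" "H d = (var_t + 1) ^ Suc e * c 0"
      using d unfolding H_def by (simp_all flip: True)
    moreover have "H (d + 1) = (if n = 2 * N then - H (d - 1) else - H d)"
      using H_anti[of "d + 1"] initial d True by auto
    ultimately show ?thesis
      using initial by (auto simp: algebra_simps)
  qed
qed

lemma H_first: "c N + (var_t + 1) * H 2 = (var_u + 2 * var_t + 3) * H 1"
proof (cases "N = 1")
  \<comment> \<open>Here \<open>n = 3\<close>, and distance 2 already lies past the
    antipode.\<close>
  case True
  then have "n = 3" "c 0 = 1" "c N = var_u + 3 * var_t + 4"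
    using initial n_ge_3 by auto
  moreover from this have "H 1 = 1" "H 2 = - 1"
    using True unfolding H_def by simp_all
  ultimately show ?thesis
    by (simp add: algebra_simps)
next
  case False
  define r where "r = N - 2"
  have N: "N = r + 2"
    using False N_pos by (simp add: r_def)
  then have "N - 2 = r" "N - 1 = r + 1" "2 \<le> N"
    by auto
  then have H: "H 2 = (var_t + 1) * c r" "H 1 = c (r + 1)"
    by (auto simp: H_def)
  have "c N = (var_u + 2 * var_t + 3) * c (r + 1) - (var_t + 1)\<^sup>2 * c r"
    using rec[of r] N by simp
  then show ?thesis
    unfolding H by (simp add: algebra_simps power2_eq_square)
qed

lemma weight_stationary: "dasep_stationary n weight"
  using n_ge_3 H_anti H_first H_step by (rule dasep_weight_stationary)

lemma weight_two_at:
  assumes "two_at n i x j y \<mu>" "x \<in> {1, 2}" "y \<in> {1, 2}"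
  shows "weight \<mu> = pair_weight (c N) H x y (cdist n i j)"
  using H_anti assms by (rule dasep_weight_two_at)

lemma c_N_pos: "0 < c N"
proof -
  have "0 < var_u + (3 * var_t + 4)" "var_t + 1 \<le> var_u + (3 * var_t + 4)"
    using var_u_pos var_t_pos by linarith+
  then have "0 < c 1 \<and> (var_t + 1) * c 0 \<le> c 1"
    using initial by (auto simp: add.assoc)
  then have "0 < c (Suc (N - 1))"
    using recurrence_pos[of var_u var_t c, OF _ _ _ _ rec] var_u_pos var_t_pos by auto
  then show ?thesis
    using N_pos by simp
qed

text \<open>Setting \<open>u = 0\<close> keeps the shape of the recurrence, so the positivity
  argument applies again over \<open>rat poly\<close>.\<close>

lemma c_N_at_0: "poly (c N) 0 \<noteq> 0"
proof -
  define t :: "rat poly" where "t = [:0, 1:]"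
  have t: "0 < t"
    by (simp add: t_def less_poly_def pos_poly_def)
  have [simp]: "poly var_u 0 = 0" "poly var_t 0 = t"
    by (simp_all add: var_u_def var_t_def t_def)
  have rec': "poly (c (k + 2)) 0 = (0 + 2 * t + 3) * poly (c (k + 1)) 0 - (t + 1)\<^sup>2 * poly (c k) 0"
    for k
    by (simp add: rec del: add_2_eq_Suc')
  have "0 < 3 * t + 4" "t + 1 \<le> 3 * t + 4"
    using t by linarith+
  then have "0 < poly (c 1) 0 \<and> (t + 1) * poly (c 0) 0 \<le> poly (c 1) 0"
    using initial by auto
  then have "0 < poly (c (Suc (N - 1))) 0"
    using recurrence_pos[of 0 t "\<lambda>k. poly (c k) 0", OF _ _ _ _ rec'] t by auto
  then show ?thesis
    using N_pos by simp
qed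

lemma c_N_monic: "lead_coeff (c N) = 1"
proof -
  define p :: "rat poly" where "p = [:3, 2:]"
  define q :: "rat poly" where "q = [:1, 1:]\<^sup>2"
  have t1: "var_t + 1 = [:[:1, 1:]:]"
    by (simp add: var_t_def one_pCons)
  have u: "var_u + 2 * var_t + 3 = [:p, 1:]"
    by (simp add: var_u_def var_t_def p_def numeral_poly)
  have "(var_t + 1)\<^sup>2 = [:q:]"
    by (simp add: t1 q_def power2_eq_square)
  then have rec': "c (k + 2) = [:p, 1:] * c (k + 1) - [:q:] * c k" for k
    using rec[of k] u by simp
  have "var_u + 3 * var_t + 4 = [:[:4, 3:], 1:]"
    by (simp add: var_u_def var_t_def numeral_poly)
  then have "lead_coeff (c 1) = 1 \<and> degree (c 0) \<le> degree (c 1)"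
    using initial by auto
  then have "lead_coeff (c (Suc (N - 1))) = 1"
    using recurrence_monic[of c p q, OF _ _ rec'] by blast
  then show ?thesis
    using N_pos by simp
qed

lemma weight_Gcd: "Gcd (weight ` dasep_states n) = 1"
proof -
  let ?G = "Gcd (weight ` dasep_states n)"
  have G: "?G dvd weight \<mu>" if "\<mu> \<in> dasep_states n" for \<mu>
    using that by (intro Gcd_dvd) auto
  \<comment> \<open>This distance makes \<open>c (N - d) = 1\<close>: index 0 for odd
    \<open>n\<close>, index 1 for even \<open>n\<close>. Then \<open>H d\<close> is a pure power of
    \<open>var_t + 1\<close>.\<close>
  define d where "d = (if n = 2 * N then N - 1 else N)"
  have d: "0 < d" "d < n"
    using initial n_ge_3 by (auto simp: d_def)
  have "N - d = (if n = 2 * N then 1 else 0)" "d \<le> N"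
    using N_pos by (auto simp: d_def)
  then have H: "H d = (var_t + 1) ^ (d - 1)"
    using initial by (auto simp: H_def)
  obtain \<mu> \<nu> where \<mu>: "two_at n 0 1 d 1 \<mu>" and \<nu>: "two_at n 0 1 d 2 \<nu>"
    using two_at_ex[of 0 n d] d by blast
  have "?G dvd weight \<mu>"
    by (intro G two_at_in_states[OF \<mu>]) auto
  also have "weight \<mu> = c N"
    using weight_two_at[OF \<mu>] by (simp add: pair_weight_def)
  finally have G1: "?G dvd c N" .
  have "?G dvd weight \<nu>"
    by (intro G two_at_in_states[OF \<nu>]) auto
  also have "weight \<nu> = c N * var_u + var_u * (var_t - 1) * (var_t + 1) ^ (d - 1)"
    using weight_two_at[OF \<nu>] d by (simp add: pair_weight_def cdist_eq H)
  finally have "?G dvd var_u * ((var_t - 1) * (var_t + 1) ^ (d - 1))"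
    using G1 by (simp add: dvd_add_right_iff mult.assoc)
  moreover obtain p where p: "(var_t - 1) * (var_t + 1) ^ (d - 1) = [:p:]" "p \<noteq> 0"
  proof -
    have t: "var_t - 1 = [:[:-1, 1:]:]" "var_t + 1 = [:[:1, 1:]:]"
      by (simp_all add: var_t_def one_pCons)
    then have "degree ((var_t - 1) * (var_t + 1) ^ (d - 1)) = 0"
      by (subst degree_mult_eq) (auto simp: degree_power_eq)
    moreover have "(var_t - 1) * (var_t + 1) ^ (d - 1) \<noteq> 0"
      using t by simp
    ultimately show thesis
      using that by (metis degree_eq_zeroE pCons_eq_0_iff)
  qed
  ultimately have "is_unit ?G"
    using common_divisor_monic_is_unit[OF c_N_monic c_N_at_0 G1] by (simp add: var_u_def)
  then show ?thesis
    by (metis is_unit_normalize normalize_Gcd)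
qed

lemma weight_unnormalized: "dasep_unnormalized n weight"
  by (simp add: dasep_unnormalized_def weight_stationary weight_Gcd)

lemma unnormalized_eq_weight:
  assumes "dasep_unnormalized n \<pi>"
  shows "\<exists>z. z \<noteq> 0 \<and> (\<forall>\<mu>\<in>dasep_states n. \<pi> \<mu> = const_ut z * weight \<mu>)"
proof -
  obtain \<mu> where \<mu>: "two_at n 0 1 1 1 \<mu>"
    using two_at_ex[of 0 n 1] n_ge_3 by auto
  then have "weight \<mu> = c N"
    using weight_two_at[OF \<mu>] by (simp add: pair_weight_def)
  then have "weight \<mu> \<noteq> 0"
    using c_N_pos by simp
  with \<mu> assms weight_unnormalized n_ge_3 show ?thesis
    by (intro dasep_unnormalized_unique) auto
qed

text \<open>The exponent \<open>2 * (x - 1)\<close> yields the factor 1 for \<open>x = 1\<close> and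
  \<open>u\<close> squared for \<open>x = 2\<close>.\<close>

lemma rearrangement_weight:
  assumes \<mu>: "\<mu> \<in> rearrangements ([x, x] @ replicate (n - 2) 0)" and x: "x \<in> {1, 2}"
  shows "\<mu> \<in> dasep_states n \<and> weight \<mu> = var_u ^ (2 * (x - 1)) * c N"
proof -
  have m: "mset \<mu> = mset ([x, x] @ replicate (n - 2) 0)"
    using \<mu> by (simp add: rearrangements_def permutations_of_multiset_def)
  then have len: "length \<mu> = n" and set: "set \<mu> \<subseteq> {0, x}"
    using n_ge_3 mset_eq_length[OF m] mset_eq_setD[OF m] by (auto split: if_splits)
  have "card {i. i < n \<and> \<mu> ! i \<noteq> 0} = size (filter_mset (\<lambda>z. z \<noteq> 0) (mset \<mu>))"
    unfolding mset_filter[symmetric] size_mset length_filter_conv_card len ..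
  also have "\<dots> = 2"
    unfolding m using x by (auto simp flip: mset_filter)
  finally have in_S: "\<mu> \<in> dasep_states n"
    using len set x by (auto simp: dasep_states_def)
  then obtain i y j z where at: "two_at n i y j z \<mu>" and y: "y \<in> {1, 2}" and z: "z \<in> {1, 2}"
    using dasep_states_two_at by blast
  then have "y \<in> set \<mu>" "z \<in> set \<mu>"
    unfolding two_at_def by (metis nth_mem)+
  with set y z have "y = x" "z = x"
    by auto
  with in_S weight_two_at[OF at y z] x show ?thesis
    by (auto simp: pair_weight_def power2_eq_square)
qed

text \<open>A gap of \<open>m\<close> holes is distance \<open>m + 1\<close>, which
  \<open>m < N\<close> places in the first branch of \<open>H\<close>. This bound reads
  \<open>m < k\<close> for \<open>n = 2 * k + 1\<close> and \<open>m \<le> k\<close> for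
  \<open>n = 2 * k + 2\<close>.\<close>

lemma gap_state_weight:
  assumes \<mu>: "gap_state n x m y \<mu>" and m: "m < N"
    and x: "x \<in> {1, 2}" and y: "y \<in> {1, 2}" and "x \<noteq> y"
  shows "\<mu> \<in> dasep_states n \<and> weight \<mu> = var_u * c N +
    (if x = 1 then 1 else -1) * (var_u * (var_t - 1) * (var_t + 1) ^ m * c (N - m - 1))"
proof -
  obtain i where i: "i < n" and at: "\<mu> ! i = x" "\<mu> ! ((i + m + 1) mod n) = y"
    and zero: "\<forall>j<n. j \<noteq> i \<and> j \<noteq> (i + m + 1) mod n \<longrightarrow> \<mu> ! j = 0" and len: "length \<mu> = n"
    using \<mu> by (auto simp: gap_state_def)
  define j where "j = (i + m + 1) mod n"
  have mn: "m + 1 < n"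
    using m initial n_ge_3 by linarith
  then have j: "j = (if i + m + 1 < n then i + m + 1 else i + m + 1 - n)"
    using i by (auto simp: j_def mod_if)
  have jn: "j < n" "i \<noteq> j" "cdist n i j = m + 1"
    using i mn by (auto simp: cdist_eq j split: if_splits)
  have at: "two_at n i x j y \<mu>"
    using i jn at zero len unfolding two_at_def j_def by blast
  have "H (m + 1) = (var_t + 1) ^ m * c (N - m - 1)"
    using m by (simp add: H_def)
  then have "weight \<mu> = var_u * c N +
      (if x = 1 then 1 else -1) * (var_u * (var_t - 1) * (var_t + 1) ^ m * c (N - m - 1))"
    using weight_two_at[OF at x y] x y \<open>x \<noteq> y\<close> jn by (auto simp: pair_weight_def mult.assoc mult.commute)
  then show ?thesis
    using two_at_in_states[OF at x y] by blast
qed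

end

section \<open>The stationary distribution\<close>

theorem theorem4p1:
  fixes a :: "nat \<Rightarrow> poly_ut" and b :: "int \<Rightarrow> poly_ut" and n :: nat
  assumes a_0: "a 0 = 1"
    and a_1: "a 1 = var_u + 3 * var_t + 4"
    and a_rec: "\<And>k. k \<ge> 2 \<Longrightarrow>
          a k = (var_u + 2 * var_t + 3) * a (k - 1) - (var_t + 1)^2 * a (k - 2)"
    and b_m1: "b (-1) = 0"
    and b_0: "b 0 = 1"
    and b_rec: "\<And>k. k \<ge> 1 \<Longrightarrow>
          b k = (var_u + 2 * var_t + 3) * b (k - 1) - (var_t + 1)^2 * b (k - 2)"
    and n: "n \<ge> 3"
  shows "(\<exists>\<pi>. dasep_unnormalized n \<pi>) \<and>
    (\<forall>\<pi>. dasep_unnormalized n \<pi> \<longrightarrow>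
      (\<exists>c. c \<noteq> 0 \<and>
        (\<forall>k. n = 2 * k + 1 \<longrightarrow>
          (\<forall>\<mu> \<in> rearrangements ([1, 1] @ replicate (n - 2) 0).
             \<pi> \<mu> = const_ut c * a k) \<and>
          (\<forall>m \<mu>. m < k \<and> gap_state n 1 m 2 \<mu> \<longrightarrow>
             \<pi> \<mu> = const_ut c *
               (var_u * a k + var_u * (var_t - 1) * (var_t + 1)^m * a (k - m - 1))) \<and>
          (\<forall>m \<mu>. m < k \<and> gap_state n 2 m 1 \<mu> \<longrightarrow>
             \<pi> \<mu> = const_ut c *
               (var_u * a k - var_u * (var_t - 1) * (var_t + 1)^m * a (k - m - 1))) \<and>
          (\<forall>\<mu> \<in> rearrangements ([2, 2] @ replicate (n - 2) 0).
             \<pi> \<mu> = const_ut c * (var_u^2 * a k))) \<and>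
        (\<forall>k. n = 2 * k + 2 \<longrightarrow>
          (\<forall>\<mu> \<in> rearrangements ([1, 1] @ replicate (n - 2) 0).
             \<pi> \<mu> = const_ut c * b (int k)) \<and>
          (\<forall>m \<mu>. m \<le> k \<and> gap_state n 1 m 2 \<mu> \<longrightarrow>
             \<pi> \<mu> = const_ut c *
               (var_u * b (int k)
                + var_u * (var_t - 1) * (var_t + 1)^m * b (int k - int m - 1))) \<and>
          (\<forall>m \<mu>. m \<le> k \<and> gap_state n 2 m 1 \<mu> \<longrightarrow>
             \<pi> \<mu> = const_ut c *
               (var_u * b (int k)
                - var_u * (var_t - 1) * (var_t + 1)^m * b (int k - int m - 1))) \<and>
          (\<forall>\<mu> \<in> rearrangements ([2, 2] @ replicate (n - 2) 0).
             \<pi> \<mu> = const_ut c * (var_u^2 * b (int k))))))"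
proof (intro conjI allI impI)
  define N where "N = n div 2"
  \<comment> \<open>The shift gives \<open>c 0 = b (-1)\<close> for even \<open>n\<close>, and
    \<open>c N = b k\<close> when \<open>n = 2 * k + 2\<close>.\<close>
  define c where "c k = (if odd n then a k else b (int k - 1))" for k
  interpret dasep_profile n N c
  proof
    show "c (k + 2) = (var_u + 2 * var_t + 3) * c (k + 1) - (var_t + 1)\<^sup>2 * c k" for k
      using a_rec[of "k + 2"] b_rec[of "int k + 1"] by (simp add: c_def add.commute[of 1 "int k"])
    show "n = 2 * N + 1 \<and> c 0 = 1 \<and> c 1 = var_u + 3 * var_t + 4 \<or>
        n = 2 * N \<and> c 0 = 0 \<and> c 1 = 1"
      using a_0 a_1 b_m1 b_0 by (cases "odd n") (auto simp: N_def c_def)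
  qed (use n in simp)
  show "\<exists>\<pi>. dasep_unnormalized n \<pi>"
    using weight_unnormalized by blast
  fix \<pi> assume "dasep_unnormalized n \<pi>"
  then obtain z where z: "z \<noteq> 0"
    and \<pi>: "\<And>\<mu>. \<mu> \<in> dasep_states n \<Longrightarrow> \<pi> \<mu> = const_ut z * weight \<mu>"
    using unnormalized_eq_weight by blast
  have ones: "\<pi> \<mu> = const_ut z * c N"
    if "\<mu> \<in> rearrangements ([1, 1] @ replicate (n - 2) 0)" for \<mu>
    using rearrangement_weight[OF that] \<pi> by simp
  have twos: "\<pi> \<mu> = const_ut z * (var_u^2 * c N)"
    if "\<mu> \<in> rearrangements ([2, 2] @ replicate (n - 2) 0)" for \<mu>
    using rearrangement_weight[OF that] \<pi> by simp
  have gap12: "\<pi> \<mu> = const_ut z *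
      (var_u * c N + var_u * (var_t - 1) * (var_t + 1)^m * c (N - m - 1))"
    if "gap_state n 1 m 2 \<mu>" "m < N" for m \<mu>
    using gap_state_weight[OF that] \<pi> by simp
  have gap21: "\<pi> \<mu> = const_ut z *
      (var_u * c N - var_u * (var_t - 1) * (var_t + 1)^m * c (N - m - 1))"
    if "gap_state n 2 m 1 \<mu>" "m < N" for m \<mu>
    using gap_state_weight[OF that] \<pi> by simp
  have odd_case: "N = k" "c = a" if "n = 2 * k + 1" for k
    using that by (auto simp: N_def c_def)
  have even_case: "N = k + 1" "c N = b (int k)" if "n = 2 * k + 2" for k
    using that by (auto simp: N_def c_def)
  have even_gap: "c (N - m - 1) = b (int k - int m - 1)" if "n = 2 * k + 2" "m \<le> k" for k m
    using that by (auto simp: N_def c_def of_nat_diff)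
  show "(\<exists>c. c \<noteq> 0 \<and>
        (\<forall>k. n = 2 * k + 1 \<longrightarrow>
          (\<forall>\<mu> \<in> rearrangements ([1, 1] @ replicate (n - 2) 0).
             \<pi> \<mu> = const_ut c * a k) \<and>
          (\<forall>m \<mu>. m < k \<and> gap_state n 1 m 2 \<mu> \<longrightarrow>
             \<pi> \<mu> = const_ut c *
               (var_u * a k + var_u * (var_t - 1) * (var_t + 1)^m * a (k - m - 1))) \<and>
          (\<forall>m \<mu>. m < k \<and> gap_state n 2 m 1 \<mu> \<longrightarrow>
             \<pi> \<mu> = const_ut c *
               (var_u * a k - var_u * (var_t - 1) * (var_t + 1)^m * a (k - m - 1))) \<and>
          (\<forall>\<mu> \<in> rearrangements ([2, 2] @ replicate (n - 2) 0).
             \<pi> \<mu> = const_ut c * (var_u^2 * a k))) \<and>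
        (\<forall>k. n = 2 * k + 2 \<longrightarrow>
          (\<forall>\<mu> \<in> rearrangements ([1, 1] @ replicate (n - 2) 0).
             \<pi> \<mu> = const_ut c * b (int k)) \<and>
          (\<forall>m \<mu>. m \<le> k \<and> gap_state n 1 m 2 \<mu> \<longrightarrow>
             \<pi> \<mu> = const_ut c *
               (var_u * b (int k)
                + var_u * (var_t - 1) * (var_t + 1)^m * b (int k - int m - 1))) \<and>
          (\<forall>m \<mu>. m \<le> k \<and> gap_state n 2 m 1 \<mu> \<longrightarrow>
             \<pi> \<mu> = const_ut c *
               (var_u * b (int k)
                - var_u * (var_t - 1) * (var_t + 1)^m * b (int k - int m - 1))) \<and>
          (\<forall>\<mu> \<in> rearrangements ([2, 2] @ replicate (n - 2) 0).
             \<pi> \<mu> = const_ut c * (var_u^2 * b (int k)))))"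
  proof (intro exI[of _ z] conjI allI impI ballI; (elim conjE)?)
    show "z \<noteq> 0"
      by (fact z)
  qed (use ones twos gap12 gap21 odd_case even_case even_gap in \<open>force\<close>)+
qed

end
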